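(* Let $G$ be a graph such that for some integers $d,c\geq 0$ and $k\geq 1$: (1) at most $d$ vertices in $G$ have infinite degree; (2) $G$ does not contain $k$ pairwise disjoint 1-way infinite paths; and (3) every finite subgraph of $G$ has path-width at most $c$. Then $\mathrm{pw}(G)\leq 2c+(3k-2)(2c+1)+d$.
   Context: All graphs are simple and countable (the vertex set is finite or countably infinite). A graph $U$ contains a graph $G$ if a subgraph of $U$ is isomorphic to $G$. Paths are disjoint if they are vertex-disjoint subgraphs. The 1-way infinite path is, up to isomorphism, the graph with vertex set $\mathbb{N}$ and edge set $\{\{n,n+1\}:n\in\mathbb{N}\}$. A path-decomposition of a graph $G$ is a sequence $(B_t:t\in\mathbb{N})$ of subsets of $V(G)$ (bags) such that: $\bigcup_{t}B_t=V(G)$; for each edge $vw\in E(G)$ there is $t\in\mathbb{N}$ with $v,w\in B_t$; and $B_{t_1}\cap B_{t_3}\subseteq B_{t_2}$ whenever $t_1\leq t_2\leq t_3$. Its width is $\sup_{t\in\mathbb{N}}(|B_t|-1)$. The path-width $\mathrm{pw}(G)$ is the minimum width of a path-decomposition of $G$ (it is $\infty$ if every path-decomposition has bags of unbounded size). *)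

theory Defs
  imports "HOL-Library.Extended_Real" "HOL-Library.Countable_Set"
begin

record 'a ugraph =
  verts :: "'a set"
  edges :: "'a set set"

definition countable_simple_graph :: "'a ugraph \<Rightarrow> bool" where
  "countable_simple_graph G \<longleftrightarrow>
     countable (verts G) \<and> (\<forall>e \<in> edges G. e \<subseteq> verts G \<and> card e = 2)"

definition subgraph :: "'a ugraph \<Rightarrow> 'a ugraph \<Rightarrow> bool" where
  "subgraph H G \<longleftrightarrow>
     countable_simple_graph H \<and> verts H \<subseteq> verts G \<and> edges H \<subseteq> edges G"

definition isomorphic :: "'a ugraph \<Rightarrow> 'b ugraph \<Rightarrow> bool" where
  "isomorphic G H \<longleftrightarrow>
     (\<exists>f. bij_betw f (verts G) (verts H) \<and>
          (\<forall>u \<in> verts G. \<forall>v \<in> verts G. {u, v} \<in> edges G \<longleftrightarrow> {f u, f v} \<in> edges H))"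

definition neighbours :: "'a ugraph \<Rightarrow> 'a \<Rightarrow> 'a set" where
  "neighbours G v = {w \<in> verts G. {v, w} \<in> edges G}"

definition infinite_degree_verts :: "'a ugraph \<Rightarrow> 'a set" where
  "infinite_degree_verts G = {v \<in> verts G. infinite (neighbours G v)}"

definition one_way_infinite_path :: "nat ugraph" where
  "one_way_infinite_path = \<lparr>verts = UNIV, edges = {{n, n + 1} | n. True}\<rparr>"

definition contains_disjoint_rays :: "'a ugraph \<Rightarrow> nat \<Rightarrow> bool" where
  "contains_disjoint_rays G k \<longleftrightarrow>
     (\<exists>P :: nat \<Rightarrow> 'a ugraph.
        (\<forall>i < k. subgraph (P i) G \<and> isomorphic (P i) one_way_infinite_path) \<and>
        (\<forall>i < k. \<forall>j < k. i \<noteq> j \<longrightarrow> verts (P i) \<inter> verts (P j) = {}))"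

definition path_decomposition :: "'a ugraph \<Rightarrow> (nat \<Rightarrow> 'a set) \<Rightarrow> bool" where
  "path_decomposition G B \<longleftrightarrow>
     (\<Union>t. B t) = verts G \<and>
     (\<forall>v w. {v, w} \<in> edges G \<longrightarrow> (\<exists>t. v \<in> B t \<and> w \<in> B t)) \<and>
     (\<forall>t1 t2 t3. t1 \<le> t2 \<and> t2 \<le> t3 \<longrightarrow> B t1 \<inter> B t3 \<subseteq> B t2)"

(* Bags may be infinite, for which card returns 0; an empty bag contributes -1. *)

definition ext_card :: "'a set \<Rightarrow> ereal" where
  "ext_card A = (if finite A then ereal (real (card A)) else \<infinity>)"

definition width :: "(nat \<Rightarrow> 'a set) \<Rightarrow> ereal" where
  "width B = (SUP t. ext_card (B t) - 1)"

(* The infimum is a minimum, see pathwidth_attained. *)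

definition pathwidth :: "'a ugraph \<Rightarrow> ereal" where
  "pathwidth G = (INF B \<in> {B. path_decomposition G B}. width B)"

lemma width_le_iff:
  "width B \<le> ereal (real n - 1) \<longleftrightarrow> (\<forall>t. finite (B t) \<and> card (B t) \<le> n)"
proof -
  have "ext_card A - 1 \<le> ereal (real n - 1) \<longleftrightarrow> finite A \<and> card A \<le> n" for A :: "'a set"
    by (auto simp: ext_card_def one_ereal_def)
  then show ?thesis
    by (simp add: width_def SUP_le_iff)
qed

lemma pathwidth_attained:
  assumes "countable_simple_graph G"
  shows "\<exists>B. path_decomposition G B \<and> width B = pathwidth G"
proof -
  let ?P = "\<lambda>n. \<exists>B. path_decomposition G B \<and> width B \<le> ereal (real n - 1)"
  have *: ?thesis
    if "path_decomposition G B" "\<And>C. path_decomposition G C \<Longrightarrow> width B \<le> width C" for B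
  proof -
    have "pathwidth G = width B"
      unfolding pathwidth_def using that by (intro antisym INF_lower INF_greatest) auto
    with that(1) show ?thesis by auto
  qed
  have below: "\<exists>n. width C \<le> ereal (real n - 1) \<and> ereal (real n - 1) \<le> width C"
    if fin: "width C \<noteq> \<infinity>" for C :: "nat \<Rightarrow> 'a set"
  proof -
    obtain r where r: "width C \<le> ereal r"
      using fin by (cases "width C") auto
    obtain m where "r \<le> real m - 1"
      using real_arch_simple[of "r + 1"] by (auto simp: algebra_simps)
    then have "ereal r \<le> ereal (real m - 1)"
      by simp
    with r have "width C \<le> ereal (real m - 1)"
      by (rule order_trans)
    then have m: "\<forall>t. finite (C t) \<and> card (C t) \<le> m"
      by (simp add: width_le_iff)
    define n where "n = Max (range (\<lambda>t. card (C t)))"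
    have f: "finite (range (\<lambda>t. card (C t)))"
    proof (rule finite_subset)
      show "range (\<lambda>t. card (C t)) \<subseteq> {..m}"
        using m by blast
    qed simp
    have "card (C t) \<le> n" for t
      unfolding n_def by (rule Max_ge[OF f rangeI])
    with m have upper: "width C \<le> ereal (real n - 1)"
      by (simp add: width_le_iff)
    obtain t where "n = card (C t)"
      using Max_in[OF f] unfolding n_def by auto
    then have "ereal (real n - 1) = ext_card (C t) - 1"
      using m by (simp add: ext_card_def one_ereal_def)
    moreover have "ext_card (C t) - 1 \<le> width C"
      unfolding width_def by (rule SUP_upper) simp
    ultimately have "ereal (real n - 1) \<le> width C"
      by simp
    with upper show ?thesis by blast
  qed
  show ?thesis
  proof (cases "\<exists>n. ?P n")
    case True
    define n where "n = (LEAST n. ?P n)"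
    have "?P n"
      unfolding n_def by (rule LeastI_ex[OF True])
    then obtain B where B: "path_decomposition G B" "width B \<le> ereal (real n - 1)"
      by blast
    have "width B \<le> width C" if C: "path_decomposition G C" for C
    proof (cases "width C = \<infinity>")
      case False
      then obtain m where m: "width C \<le> ereal (real m - 1)" "ereal (real m - 1) \<le> width C"
        using below by blast
      have "n \<le> m"
        unfolding n_def using C m(1) by (intro Least_le) blast
      then have "ereal (real n - 1) \<le> ereal (real m - 1)"
        by simp
      with B(2) have "width B \<le> ereal (real m - 1)"
        by (rule order_trans)
      then show ?thesis
        using m(2) by (rule order_trans)
    qed simp
    with B(1) show ?thesis by (rule *)
  next
    case False
    then have inf: "width C = \<infinity>" if "path_decomposition G C" for C
      using that below by blast
    have trivial: "path_decomposition G (\<lambda>_. verts G)"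
      using assms by (auto simp: path_decomposition_def countable_simple_graph_def)
    show ?thesis
    proof (rule *[OF trivial])
      show "width (\<lambda>_. verts G) \<le> width C" if "path_decomposition G C" for C
        using inf[OF that] by simp
    qed
  qed
qed

end

theory Submission
  imports Defs
begin

text \<open>Delete the vertices of infinite degree; they are put back into every bag. In the remaining locally
  finite graph, an injection that moves every vertex within its closed neighbourhood and omits \<open>k\<close>
  vertices yields \<open>k\<close> disjoint rays, the orbits of the omitted vertices. Hence Hall's condition fails,
  and its failure provides, around any finite set, a finite set with fewer than \<open>k\<close> boundary vertices.
  Exhaust the graph by such sets and concatenate finite path-decompositions of the successive
  differences, each bag enlarged by the two boundaries next to it. This gives width at most
  \<open>c + 2 (k - 1) + d\<close>.\<close>

section \<open>Hall's theorem for countable families of finite sets\<close>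

text \<open>As infinite sets have cardinality 0, Hall's condition forces all members to be finite.\<close>

definition hall :: "'i set \<Rightarrow> ('i \<Rightarrow> 'b set) \<Rightarrow> bool" where
  "hall I A \<longleftrightarrow> (\<forall>J \<subseteq> I. finite J \<longrightarrow> card J \<le> card (\<Union>(A ` J)))"

lemma hallD: "hall I A \<Longrightarrow> J \<subseteq> I \<Longrightarrow> finite J \<Longrightarrow> card J \<le> card (\<Union>(A ` J))"
  by (simp add: hall_def)

lemma hall_member:
  assumes "hall I A" "i \<in> I"
  shows "finite (A i)" "A i \<noteq> {}"
proof -
  have "1 \<le> card (A i)"
    using hallD[OF assms(1), of "{i}"] assms(2) by simp
  then show "finite (A i)" "A i \<noteq> {}"
    by (auto intro: card_ge_0_finite)
qed

text \<open>Only member \<open>i\<close> changes, so a violating index set must contain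
  \<open>i\<close>. Removing \<open>i\<close> from it costs one index and weakens the strict
  inequality to \<open>\<le>\<close>; this form lets \<open>hall_refine\<close> add up two
  violations.\<close>

lemma hall_upd_violation:
  assumes "hall I A" "i \<in> I" "\<not> hall I (A(i := X))"
  obtains J where "J \<subseteq> I - {i}" "finite J" "card (\<Union>(A ` J) \<union> X) \<le> card J"
proof -
  obtain J where J: "J \<subseteq> I" "finite J" "card (\<Union>((A(i := X)) ` J)) < card J"
    using assms(3) by (auto simp: hall_def not_le)
  have "i \<in> J"
  proof (rule ccontr)
    assume "i \<notin> J"
    then have "(A(i := X)) ` J = A ` J" by auto
    then show False using J hallD[OF assms(1) J(1,2)] by simp
  qed
  then have "\<Union>((A(i := X)) ` J) = \<Union>(A ` (J - {i})) \<union> X"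
    by (auto split: if_splits)
  then have "card (\<Union>(A ` (J - {i})) \<union> X) \<le> card (J - {i})"
    using J \<open>i \<in> J\<close> by (simp add: card_Diff_singleton)
  then show thesis
    using J by (intro that[of "J - {i}"]) auto
qed

text \<open>Rado's argument: if deleting either of two elements \<open>x\<close>, \<open>y\<close> from one member destroyed Hall's
  condition, the union and the intersection of the two violating index sets would violate it already.\<close>

lemma hall_refine:
  assumes hall: "hall I A" and i: "i \<in> I"
  shows "\<exists>x \<in> A i. hall I (A(i := {x}))"
proof -
  let ?P = "\<lambda>X. X \<subseteq> A i \<and> hall I (A(i := X))"
  \<comment> \<open>Choose \<open>X\<close> of least cardinality among the subsets of
    \<open>A i\<close> that keep Hall's condition. All candidates are finite by
    \<open>hall_member\<close>, so it remains to exclude two elements in \<open>X\<close>.\<close>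
  have "?P (A i)" using hall by simp
  then obtain X where X: "?P X" and min: "\<And>Y. ?P Y \<Longrightarrow> card X \<le> card Y"
    using ex_has_least_nat[of ?P "A i" card] by blast
  have finX: "finite X" "X \<noteq> {}"
    using hall_member[of I "A(i := X)" i] X i by auto
  have "\<exists>x. X = {x}"
  proof (rule ccontr)
    assume no: "\<nexists>x. X = {x}"
    obtain x where x: "x \<in> X" using finX by blast
    obtain y where y: "y \<in> X" "y \<noteq> x" using no x by blast
    have fail: "\<not> hall I (A(i := X - {z}))" if "z \<in> X" for z
    proof
      assume "hall I (A(i := X - {z}))"
      then have "card X \<le> card (X - {z})" using X by (intro min) auto
      then show False using finX that by (meson card_Diff1_less not_le)
    qed
    have hX: "hall I (A(i := X))" using X by simp
    have viol: "\<exists>J. J \<subseteq> I - {i} \<and> finite J \<and> card (\<Union>(A ` J) \<union> (X - {z})) \<le> card J"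
      if z: "z \<in> X" for z
    proof -
      obtain J where J: "J \<subseteq> I - {i}" "finite J"
        "card (\<Union>((A(i := X)) ` J) \<union> (X - {z})) \<le> card J"
        using hall_upd_violation[OF hX i, of "X - {z}"] fail[OF z] by auto
      have "(A(i := X)) ` J = A ` J" using J(1) by auto
      then show ?thesis using J by auto
    qed
    obtain J where J: "J \<subseteq> I - {i}" "finite J" "card (\<Union>(A ` J) \<union> (X - {x})) \<le> card J"
      using viol[OF x] by blast
    obtain K where K: "K \<subseteq> I - {i}" "finite K" "card (\<Union>(A ` K) \<union> (X - {y})) \<le> card K"
      using viol[OF y(1)] by blast
    let ?P = "\<Union>(A ` J) \<union> (X - {x})" and ?Q = "\<Union>(A ` K) \<union> (X - {y})"
    have fin: "finite ?P" "finite ?Q"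
      using J K hall_member[OF hall] finX by auto
    \<comment> \<open>As \<open>x \<noteq> y\<close>, the set \<open>?P \<union> ?Q\<close> contains
      all of \<open>X\<close>, so Hall's condition can be used with the index \<open>i\<close>
      included. This additional index makes the inequality strict.\<close>
    have "card (insert i (J \<union> K)) \<le> card (\<Union>((A(i := X)) ` insert i (J \<union> K)))"
      using J K i by (intro hallD[OF hX]) auto
    also have "\<dots> \<le> card (?P \<union> ?Q)"
      using fin x y by (intro card_mono) (auto split: if_splits)
    finally have 1: "card (J \<union> K) < card (?P \<union> ?Q)"
      using J K by (subst (asm) card_insert_disjoint) auto
    have "card (J \<inter> K) \<le> card (\<Union>(A ` (J \<inter> K)))"
      using J K by (intro hallD[OF hall]) auto
    also have "\<dots> \<le> card (?P \<inter> ?Q)"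
      using fin by (intro card_mono) auto
    finally have 2: "card (J \<inter> K) \<le> card (?P \<inter> ?Q)" .
    have "card (J \<union> K) + card (J \<inter> K) = card J + card K"
      "card (?P \<union> ?Q) + card (?P \<inter> ?Q) = card ?P + card ?Q"
      using card_Un_Int[OF J(2) K(2)] card_Un_Int[OF fin] by simp_all
    with 1 2 J(3) K(3) show False by linarith
  qed
  with X show ?thesis by auto
qed

text \<open>Run through the indices and shrink one member at a time to a singleton by
  \<open>hall_refine\<close>. Hall's condition survives every stage, so no member ever becomes empty
  and a singleton never changes again; these singletons give the representatives.\<close>

lemma hall_countable:
  assumes I: "countable I" and hall: "hall I A"
  obtains f where "inj_on f I" "\<And>i. i \<in> I \<Longrightarrow> f i \<in> A i"
proof (cases "I = {}")
  case True
  then show thesis by (auto intro: that)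
next
  case False
  define e where "e = from_nat_into I"
  have e: "range e = I" unfolding e_def using False I by (rule range_from_nat_into)
  then have eI: "e n \<in> I" for n by auto
  define step where "step B i = B(i := {SOME x. x \<in> B i \<and> hall I (B(i := {x}))})"
    for B :: "'a \<Rightarrow> 'b set" and i
  have step: "hall I (step B i) \<and> step B i j \<subseteq> B j \<and> (\<exists>x. step B i i = {x})"
    if B: "hall I B" "i \<in> I" for B i j
  proof -
    have "\<exists>x. x \<in> B i \<and> hall I (B(i := {x}))"
      using hall_refine[OF B] by blast
    from someI_ex[OF this] show ?thesis
      by (auto simp: step_def)
  qed
  \<comment> \<open>\<open>B n\<close> is the family after \<open>n\<close> refinements. The
    enumeration \<open>e\<close> may repeat indices, but refining a singleton leaves it as it
    is.\<close>
  define B where "B = rec_nat A (\<lambda>n C. step C (e n))"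
  have B0: "B 0 = A" and BS: "B (Suc n) = step (B n) (e n)" for n
    by (simp_all add: B_def)
  have hB: "hall I (B n)" for n
    by (induction n) (simp_all add: B0 BS hall step eI)
  have "B (Suc n) j \<subseteq> B n j" for n j
    using step[OF hB eI] by (simp add: BS)
  then have anti: "B n j \<subseteq> B m j" if "m \<le> n" for m n j
    using that by (rule lift_Suc_antimono_le)
  have "\<exists>x n. B n i = {x}" if i: "i \<in> I" for i
  proof -
    obtain n where "i = e n" using i e by blast
    then show ?thesis using step[OF hB eI, of n n] by (metis BS)
  qed
  then obtain f N where f: "\<And>i. i \<in> I \<Longrightarrow> B (N i) i = {f i}"
    by metis
  have stable: "B n i = {f i}" if "i \<in> I" "N i \<le> n" for i n
    using anti[OF that(2), of i] f[OF that(1)] hall_member(2)[OF hB that(1), of n] by auto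
  show thesis
  proof (rule that)
    show "f i \<in> A i" if "i \<in> I" for i
      using anti[of 0 "N i" i] f[OF that] by (simp add: B0)
    show "inj_on f I"
    proof (rule inj_onI, rule ccontr)
      fix i j assume ij: "i \<in> I" "j \<in> I" "f i = f j" "i \<noteq> j"
      \<comment> \<open>At this stage both members are already singletons, and Hall's condition for
        the two indices forces them apart.\<close>
      let ?n = "max (N i) (N j)"
      have "B ?n i = {f i}" "B ?n j = {f j}" using ij by (simp_all add: stable)
      moreover have "card {i, j} \<le> card (\<Union>(B ?n ` {i, j}))"
        using ij by (intro hallD[OF hB]) auto
      ultimately show False using ij by simp
    qed
  qed
qed

section \<open>Rays and finite separators\<close>

lemma subgraph_trans: "subgraph H K \<Longrightarrow> subgraph K G \<Longrightarrow> subgraph H G"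
  by (auto simp: subgraph_def)

lemma contains_disjoint_rays_subgraph:
  "contains_disjoint_rays H k \<Longrightarrow> subgraph H G \<Longrightarrow> contains_disjoint_rays G k"
  unfolding contains_disjoint_rays_def by (meson subgraph_trans)

definition induced :: "'a ugraph \<Rightarrow> 'a set \<Rightarrow> 'a ugraph" where
  "induced G Y = \<lparr>verts = Y, edges = {e \<in> edges G. e \<subseteq> Y}\<rparr>"

lemma subgraph_induced:
  "countable_simple_graph G \<Longrightarrow> Y \<subseteq> verts G \<Longrightarrow> subgraph (induced G Y) G"
  by (auto simp: subgraph_def countable_simple_graph_def induced_def intro: countable_subset)

lemma edge_verts:
  assumes "countable_simple_graph G" "{v, w} \<in> edges G"
  shows "v \<in> verts G" "w \<in> verts G" "v \<noteq> w"
  using assms by (auto simp: countable_simple_graph_def)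

lemma sequence_ray:
  assumes G: "countable_simple_graph G" and inj: "inj x"
    and edge: "\<And>n. {x n, x (Suc n)} \<in> edges G"
  defines "P \<equiv> \<lparr>verts = range x, edges = range (\<lambda>n. {x n, x (Suc n)})\<rparr>"
  shows "subgraph P G" "isomorphic P one_way_infinite_path"
proof -
  have "x n \<noteq> x (Suc n)" for n using inj by (simp add: inj_eq)
  then show "subgraph P G"
    using edge edge_verts[OF G edge]
    by (auto simp: P_def subgraph_def countable_simple_graph_def)
  have im: "{x m, x n} = {x i, x (Suc i)} \<longleftrightarrow> {m, n} = {i, Suc i}" for m n i
    using inj by (auto simp: doubleton_eq_iff inj_eq)
  have "bij_betw (inv x) (range x) UNIV"
    by (intro bij_betw_inv_into) (simp add: inj bij_betw_def)
  moreover have "{x m, x n} \<in> edges P \<longleftrightarrow> {m, n} \<in> edges one_way_infinite_path" for m n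
    unfolding P_def one_way_infinite_path_def by (simp add: im image_iff)
  ultimately show "isomorphic P one_way_infinite_path"
    unfolding isomorphic_def
    by (intro exI[of _ "inv x"]) (auto simp: P_def one_way_infinite_path_def inj)
qed

text \<open>Fixed points of \<open>s\<close> encode the vertices that lie on no ray: an orbit that starts outside
  the range of \<open>s\<close> never reaches one.\<close>

lemma disjoint_rays_from_injection:
  assumes G: "countable_simple_graph G"
    and s: "inj_on s (verts G)"
    and step: "\<And>v. v \<in> verts G \<Longrightarrow> s v = v \<or> {v, s v} \<in> edges G"
    and a: "inj_on a {..<k}" "\<And>j. j < k \<Longrightarrow> a j \<in> verts G - s ` verts G"
  shows "contains_disjoint_rays G k"
proof -
  define x where "x j n = (s ^^ n) (a j)" for j :: nat and n
  have x0: "x j 0 = a j" and xS: "x j (Suc n) = s (x j n)" for j n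
    by (simp_all add: x_def)
  have sV: "s v \<in> verts G" if "v \<in> verts G" for v
    using step[OF that] that edge_verts[OF G] by metis
  have xV: "x j n \<in> verts G" if "j < k" for j n
    using a(2)[OF that] by (induction n) (auto simp: x0 xS sV)
  \<comment> \<open>If two orbits meet, cancel the injective \<open>s\<close> on both sides until
    one of them is back at its start. A start lies outside the range of \<open>s\<close>, so the
    other orbit must be at its start too.\<close>
  have eq: "i = j \<and> m = n" if "i < k" "j < k" "x i m = x j n" for i j m n
    using that
  proof (induction m arbitrary: n)
    case 0
    show ?case
    proof (cases n)
      case 0
      then show ?thesis using \<open>x i 0 = x j n\<close> that a(1) by (auto simp: x0 inj_on_def)
    next
      case (Suc n')
      then have "a i = s (x j n')" using 0 by (simp add: x0 xS)
      then show ?thesis using a(2)[OF that(1)] xV[OF that(2)] by blast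
    qed
  next
    case (Suc m)
    show ?case
    proof (cases n)
      case 0
      then have "a j = s (x i m)" using Suc by (simp add: x0 xS)
      then show ?thesis using a(2)[OF that(2)] xV[OF that(1)] by blast
    next
      case (Suc n')
      then have "s (x i m) = s (x j n')" using \<open>x i (Suc m) = x j n\<close> by (simp add: xS)
      then have "x i m = x j n'" using s xV that by (auto simp: inj_on_def)
      then show ?thesis using Suc.IH that Suc by blast
    qed
  qed
  have inj: "inj (x j)" if "j < k" for j
    using eq[OF that that] by (auto intro: injI)
  have edge: "{x j n, x j (Suc n)} \<in> edges G" if "j < k" for j n
  proof -
    have "x j (Suc n) \<noteq> x j n" using inj[OF that] by (simp add: inj_eq)
    then show ?thesis using step[OF xV[OF that]] by (auto simp: xS)
  qed
  have "range (x i) \<inter> range (x j) = {}" if "i < k" "j < k" "i \<noteq> j" for i j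
    using eq that by blast
  then show ?thesis
    unfolding contains_disjoint_rays_def
    by (intro exI[of _ "\<lambda>j. \<lparr>verts = range (x j), edges = range (\<lambda>n. {x j n, x j (Suc n)})\<rparr>"])
      (simp add: sequence_ray[OF G inj edge])
qed

text \<open>A Menger-type statement: \<open>X - F\<close> separates \<open>A\<close> from infinity. It arises from a set that violates
  Hall's condition for the closed neighbourhoods of all vertices and \<open>k\<close> further copies of the closed
  neighbourhood of \<open>A\<close>.\<close>

lemma finite_separator:
  assumes G: "countable_simple_graph G"
    and locfin: "\<And>v. v \<in> verts G \<Longrightarrow> finite (neighbours G v)"
    and rays: "\<not> contains_disjoint_rays G k"
    and A: "finite A" "A \<subseteq> verts G"
  obtains F X where "A \<subseteq> F" "F \<subseteq> X" "finite X" "X \<subseteq> verts G" "card (X - F) < k"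
    "\<And>v. v \<in> F \<Longrightarrow> neighbours G v \<subseteq> X"
proof -
  define N where "N v = insert v (neighbours G v)" for v
  have N: "finite (N v)" "N v \<subseteq> verts G" if "v \<in> verts G" for v
    using locfin[OF that] that by (auto simp: N_def neighbours_def)
  define A' where "A' = \<Union>(N ` A)"
  have A': "finite A'" "A' \<subseteq> verts G" "A \<subseteq> A'"
    using A N by (auto simp: A'_def N_def)
  define I :: "('a + nat) set" where "I = Inl ` verts G \<union> Inr ` {..<k}"
  define B :: "'a + nat \<Rightarrow> 'a set" where "B = case_sum N (\<lambda>_. A')"
  have "countable I"
    using G by (auto simp: I_def countable_simple_graph_def)
  \<comment> \<open>Distinct representatives would supply both inputs of the ray construction: those
    of the \<open>Inl\<close> indices form the injection, and those of the \<open>Inr\<close>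
    indices are \<open>k\<close> vertices that it omits.\<close>
  have "\<not> hall I B"
  proof
    assume "hall I B"
    then obtain f where f: "inj_on f I" "\<And>i. i \<in> I \<Longrightarrow> f i \<in> B i"
      using hall_countable[OF \<open>countable I\<close>] by blast
    have fN: "f (Inl v) \<in> N v" if "v \<in> verts G" for v
      using f(2)[of "Inl v"] that by (simp add: I_def B_def)
    have fA: "f (Inr j) \<in> A'" if "j < k" for j
      using f(2)[of "Inr j"] that by (simp add: I_def B_def)
    have "contains_disjoint_rays G k"
    proof (rule disjoint_rays_from_injection[OF G])
      show "inj_on (\<lambda>v. f (Inl v)) (verts G)" "inj_on (\<lambda>j. f (Inr j)) {..<k}"
        using f(1) by (auto simp: inj_on_def I_def)
      show "f (Inl v) = v \<or> {v, f (Inl v)} \<in> edges G" if "v \<in> verts G" for v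
        using fN[OF that] by (auto simp: N_def neighbours_def)
      show "f (Inr j) \<in> verts G - (\<lambda>v. f (Inl v)) ` verts G" if "j < k" for j
      proof -
        have "f (Inr j) \<noteq> f (Inl v)" if "v \<in> verts G" for v
          using inj_onD[OF f(1), of "Inr j" "Inl v"] that \<open>j < k\<close> by (auto simp: I_def)
        then show ?thesis using fA[OF that] A' by auto
      qed
    qed
    with rays show False ..
  qed
  then obtain J where J: "J \<subseteq> I" "finite J" "card (\<Union>(B ` J)) < card J"
    by (auto simp: hall_def not_le)
  \<comment> \<open>\<open>F0\<close> collects the vertices among the violating indices. Closed
    neighbourhoods contain their centres, so \<open>F0 \<subseteq> X\<close>; at most
    \<open>k\<close> further indices exist, so the violation leaves fewer than \<open>k\<close>
    vertices in \<open>X - F0\<close>.\<close>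
  define F0 where "F0 = Inl -` J"
  define X where "X = \<Union>(B ` J)"
  have F0: "F0 \<subseteq> verts G" using J(1) by (auto simp: F0_def I_def)
  have finF0: "finite F0" unfolding F0_def using J(2) by (intro finite_vimageI) auto
  have B: "finite (B i)" "B i \<subseteq> verts G" if "i \<in> I" for i
    using that N A' unfolding B_def I_def by auto blast
  have X: "finite X" "X \<subseteq> verts G"
    using J B by (auto simp: X_def)
  have NX: "N v \<subseteq> X" if "v \<in> F0" for v
    using that by (force simp: X_def F0_def B_def)
  have FX: "F0 \<subseteq> X" using NX by (auto simp: N_def)
  have Jeq: "J = Inl ` F0 \<union> Inr ` (Inr -` J)"
    by (rule set_eqI, rename_tac z, case_tac z) (auto simp: F0_def)
  \<comment> \<open>Vertex indices alone cannot violate Hall's condition because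
    \<open>F0 \<subseteq> X\<close>. Hence an \<open>Inr\<close> index occurs, and it brings the
    closed neighbourhood of \<open>A\<close> into \<open>X\<close>; this allows adding
    \<open>A\<close> to \<open>F0\<close> below.\<close>
  have "\<exists>j. Inr j \<in> J"
  proof (rule ccontr)
    assume "\<nexists>j. Inr j \<in> J"
    then have "J = Inl ` F0" using Jeq by auto
    then have "card J = card F0" by (simp add: card_image)
    also have "\<dots> \<le> card X" using X FX by (intro card_mono)
    finally show False using J by (simp add: X_def)
  qed
  then have AX: "A' \<subseteq> X" by (force simp: X_def B_def)
  have "card J \<le> card (Inl ` F0 :: ('a + nat) set) + card (Inr ` (Inr -` J) :: ('a + nat) set)"
    by (subst Jeq) (rule card_Un_le)
  also have "\<dots> = card F0 + card (Inr -` J)"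
    by (simp add: card_image del: image_vimage_eq)
  also have "card (Inr -` J) \<le> card {..<k}"
    using J(1) by (intro card_mono) (auto simp: I_def)
  finally have "card X < card F0 + k" using J(3) by (simp add: X_def)
  then have "card (X - F0) < k"
    using card_Diff_subset[OF finF0 FX] card_mono[OF X(1) FX] by linarith
  moreover have "card (X - (F0 \<union> A)) \<le> card (X - F0)"
    using X by (intro card_mono) auto
  ultimately have card: "card (X - (F0 \<union> A)) < k" by linarith
  show thesis
  proof (rule that[OF _ _ X card])
    show "F0 \<union> A \<subseteq> X" using FX AX A' by auto
    show "neighbours G v \<subseteq> X" if "v \<in> F0 \<union> A" for v
      using that NX AX by (auto simp: N_def A'_def)
  qed auto
qed

text \<open>\<open>F n\<close> acts as the interior of \<open>X n\<close>, and
  \<open>X n - F n\<close> is the boundary through which every edge leaving \<open>X n\<close>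
  passes. Placing \<open>X n\<close> inside the next interior keeps the successive boundaries
  disjoint.\<close>

definition separator_exhaustion ::
    "'a ugraph \<Rightarrow> nat \<Rightarrow> (nat \<Rightarrow> 'a set) \<Rightarrow> (nat \<Rightarrow> 'a set) \<Rightarrow> bool" where
  "separator_exhaustion G s F X \<longleftrightarrow>
     X 0 = {} \<and> (\<Union>n. X n) = verts G \<and>
     (\<forall>n. X n \<subseteq> F (Suc n) \<and> F n \<subseteq> X n \<and> finite (X n) \<and> card (X n - F n) \<le> s \<and>
        (\<forall>v \<in> F n. neighbours G v \<subseteq> X n))"

text \<open>Apply \<open>finite_separator\<close> repeatedly, each time to the previous
  \<open>X\<close> together with the next vertex of an enumeration, so that every vertex is
  eventually absorbed.\<close>

lemma separator_exhaustion_exists: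
  assumes G: "countable_simple_graph G"
    and locfin: "\<And>v. v \<in> verts G \<Longrightarrow> finite (neighbours G v)"
    and rays: "\<not> contains_disjoint_rays G k"
  shows "\<exists>F X. separator_exhaustion G (k - 1) F X"
proof -
  let ?Q = "\<lambda>A F X. A \<subseteq> F \<and> F \<subseteq> X \<and> finite X \<and> X \<subseteq> verts G \<and> card (X - F) \<le> k - 1 \<and>
    (\<forall>v \<in> F. neighbours G v \<subseteq> X)"
  have "\<exists>p. ?Q A (fst p) (snd p)" if "finite A" "A \<subseteq> verts G" for A
  proof -
    obtain F X where "A \<subseteq> F" "F \<subseteq> X" "finite X" "X \<subseteq> verts G" "card (X - F) < k"
      "\<And>v. v \<in> F \<Longrightarrow> neighbours G v \<subseteq> X"
      using finite_separator[OF G locfin rays \<open>finite A\<close> \<open>A \<subseteq> verts G\<close>] by metis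
    then show ?thesis by (intro exI[of _ "(F, X)"]) auto
  qed
  then obtain \<sigma> where \<sigma>: "\<And>A. finite A \<Longrightarrow> A \<subseteq> verts G \<Longrightarrow> ?Q A (fst (\<sigma> A)) (snd (\<sigma> A))"
    by metis
  \<comment> \<open>\<open>e n\<close> holds at most one vertex; using a set covers the numbers that
    enumerate no vertex when the graph is finite.\<close>
  define e where "e n = {v \<in> verts G. to_nat_on (verts G) v = n}" for n
  have cnt: "countable (verts G)" using G by (simp add: countable_simple_graph_def)
  have e: "finite (e n)" "e n \<subseteq> verts G" for n
  proof -
    have "inj_on (to_nat_on (verts G)) (e n)"
      using inj_on_to_nat_on[OF cnt] by (rule inj_on_subset) (auto simp: e_def)
    moreover have "finite (to_nat_on (verts G) ` e n)"
      by (rule finite_subset[of _ "{n}"]) (auto simp: e_def)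
    ultimately show "finite (e n)" using finite_imageD by blast
  qed (auto simp: e_def)
  define p where "p = rec_nat ({}, {}) (\<lambda>n q. \<sigma> (snd q \<union> e n))"
  have p0: "p 0 = ({}, {})" and pS: "p (Suc n) = \<sigma> (snd (p n) \<union> e n)" for n
    by (simp_all add: p_def)
  have P: "?Q {} (fst (p n)) (snd (p n))" for n
  proof (induction n)
    case (Suc n)
    then show ?case using \<sigma>[of "snd (p n) \<union> e n"] e[of n] by (auto simp: pS)
  qed (simp add: p0)
  have PS: "snd (p n) \<union> e n \<subseteq> fst (p (Suc n))" for n
    using \<sigma>[of "snd (p n) \<union> e n"] e[of n] P[of n] by (simp add: pS)
  have "verts G \<subseteq> (\<Union>n. snd (p n))"
  proof
    fix v assume "v \<in> verts G"
    then have "v \<in> e (to_nat_on (verts G) v)" by (simp add: e_def)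
    then have "v \<in> snd (p (Suc (to_nat_on (verts G) v)))" using PS P by blast
    then show "v \<in> (\<Union>n. snd (p n))" by blast
  qed
  then have "(\<Union>n. snd (p n)) = verts G" using P by blast
  then have "separator_exhaustion G (k - 1) (\<lambda>n. fst (p n)) (\<lambda>n. snd (p n))"
    using P PS p0 by (simp add: separator_exhaustion_def)
  then show ?thesis by blast
qed

section \<open>Concatenating path-decompositions\<close>

lemma path_decompositionD:
  assumes "path_decomposition G B"
  shows "(\<Union>t. B t) = verts G" "{v, w} \<in> edges G \<Longrightarrow> \<exists>t. v \<in> B t \<and> w \<in> B t"
    "t1 \<le> t2 \<Longrightarrow> t2 \<le> t3 \<Longrightarrow> B t1 \<inter> B t3 \<subseteq> B t2"
  using assms unfolding path_decomposition_def by blast+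

text \<open>A decomposition is indexed by all of \<open>nat\<close>, which leaves no room to append
  another. For a finite graph the first \<open>T\<close> bags already cover all vertices and edges,
  so these can serve as a finite block.\<close>

lemma finite_path_decomposition:
  assumes G: "countable_simple_graph G" and fin: "finite (verts G)"
    and pw: "pathwidth G \<le> ereal (real c)"
  obtains B T where "path_decomposition G B" "\<And>t. finite (B t)" "\<And>t. card (B t) \<le> Suc c"
    "\<And>v. v \<in> verts G \<Longrightarrow> \<exists>t<T. v \<in> B t"
    "\<And>v w. {v, w} \<in> edges G \<Longrightarrow> \<exists>t<T. v \<in> B t \<and> w \<in> B t"
    "0 < T"
proof -
  obtain B where B: "path_decomposition G B" "width B = pathwidth G"
    using pathwidth_attained[OF G] by blast
  have "width B \<le> ereal (real (Suc c) - 1)" using B(2) pw by simp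
  then have card: "finite (B t)" "card (B t) \<le> Suc c" for t
    using width_le_iff by blast+
  \<comment> \<open>Diagonal pairs stand for vertices, so one choice of bags serves vertices and
    edges alike.\<close>
  define S where "S = {(v, w). (v = w \<and> v \<in> verts G) \<or> {v, w} \<in> edges G}"
  have S: "(v, w) \<in> S \<longleftrightarrow> (v = w \<and> v \<in> verts G) \<or> {v, w} \<in> edges G" for v w
    by (simp add: S_def)
  have "S \<subseteq> verts G \<times> verts G"
    using edge_verts[OF G] by (auto simp: S)
  then have "finite S" using fin by (meson finite_SigmaI finite_subset)
  have "\<exists>t. v \<in> B t \<and> w \<in> B t" if "(v, w) \<in> S" for v w
    using that path_decompositionD(1,2)[OF B(1)] unfolding S by blast
  then have "\<forall>p \<in> S. \<exists>t. fst p \<in> B t \<and> snd p \<in> B t"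
    by (metis prod.collapse)
  from bchoice[OF this] obtain \<tau> where \<tau>: "\<forall>p \<in> S. fst p \<in> B (\<tau> p) \<and> snd p \<in> B (\<tau> p)"
    by blast
  \<comment> \<open>The inserted 0 keeps \<open>Max\<close> defined for the empty graph, and
    \<open>Suc\<close> makes the bound strict and \<open>T\<close> positive.\<close>
  define T where "T = Suc (Max (insert 0 (\<tau> ` S)))"
  have T: "\<tau> p < T" if "p \<in> S" for p
    unfolding T_def less_Suc_eq_le using \<open>finite S\<close> that by (intro Max_ge) auto
  have *: "\<exists>t<T. v \<in> B t \<and> w \<in> B t" if "(v, w) \<in> S" for v w
    using T[OF that] bspec[OF \<tau> that] by auto
  show thesis
  proof (rule that[OF B(1) card])
    show "\<exists>t<T. v \<in> B t" if "v \<in> verts G" for v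
      using *[of v v] that by (auto simp: S)
    show "\<exists>t<T. v \<in> B t \<and> w \<in> B t" if "{v, w} \<in> edges G" for v w
      using *[of v w] that by (simp add: S)
    show "0 < T" by (simp add: T_def)
  qed
qed

text \<open>Blocks of lengths \<open>T n\<close> are laid end to end: position \<open>s\<close> is
  place \<open>r s\<close> of block \<open>b s\<close>. The partial sums \<open>o'\<close> mark
  where the blocks begin; positive lengths make them strictly increasing, so every position falls
  into a block.\<close>

lemma block_index:
  fixes T :: "nat \<Rightarrow> nat"
  assumes "\<And>n. 0 < T n"
  obtains b r :: "nat \<Rightarrow> nat"
  where "mono b" "\<And>n t. t < T n \<Longrightarrow> \<exists>s. b s = n \<and> r s = t"
    "\<And>s s'. s \<le> s' \<Longrightarrow> b s = b s' \<Longrightarrow> r s \<le> r s'"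
proof -
  define o' where "o' n = (\<Sum>i<n. T i)" for n
  have oS: "o' (Suc n) = o' n + T n" for n by (simp add: o'_def)
  have o: "strict_mono o'" using assms by (simp add: strict_mono_Suc_iff oS)
  define b where "b s = (LEAST n. s < o' (Suc n))" for s
  have b1: "s < o' (Suc (b s))" for s
    unfolding b_def
  proof (rule LeastI)
    show "s < o' (Suc s)" using strict_mono_imp_increasing[OF o, of "Suc s"] by simp
  qed
  have bI: "b s = n" if "o' n \<le> s" "s < o' (Suc n)" for s n
    unfolding b_def
  proof (rule Least_equality)
    show "s < o' (Suc n)" by (rule that(2))
    fix m assume "s < o' (Suc m)"
    with that(1) have "o' n < o' (Suc m)" by simp
    then show "n \<le> m" using strict_mono_less[OF o] by auto
  qed
  show thesis
  proof (rule that[of b "\<lambda>s. s - o' (b s)"])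
    show "mono b"
    proof (rule monoI)
      fix s s' :: nat assume "s \<le> s'"
      then have "s < o' (Suc (b s'))" using b1[of s'] by simp
      then show "b s \<le> b s'" unfolding b_def[of s] by (rule Least_le)
    qed
    show "\<exists>s. b s = n \<and> s - o' (b s) = t" if "t < T n" for n t
      using bI[of n "o' n + t"] that by (intro exI[of _ "o' n + t"]) (simp add: oS)
  qed (simp add: diff_le_mono)
qed

text \<open>The differences \<open>Y n\<close> partition the vertices. Edges run within one
  difference or between consecutive ones, and an edge from \<open>Y n\<close> to
  \<open>Y (Suc n)\<close> has its first end in the boundary \<open>S (Suc n)\<close>, which is
  contained in \<open>Y n\<close>.\<close>

lemma path_decomposition_concat:
  assumes G: "countable_simple_graph G"
    and exh: "separator_exhaustion G s F X"
    and pw: "\<And>H. subgraph H G \<Longrightarrow> finite (verts H) \<Longrightarrow> pathwidth H \<le> ereal (real c)"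
  obtains B where "path_decomposition G B" "\<And>t. finite (B t)" "\<And>t. card (B t) \<le> 2 * s + Suc c"
proof -
  have X0: "X 0 = {}" and XF: "X n \<subseteq> F (Suc n)" and FX: "F n \<subseteq> X n" and fin: "finite (X n)"
    and cover: "(\<Union>n. X n) = verts G" and card: "card (X n - F n) \<le> s"
    and nbrs: "v \<in> F n \<Longrightarrow> neighbours G v \<subseteq> X n" for n v
    using exh unfolding separator_exhaustion_def by blast+
  define Y where "Y n = X (Suc n) - X n" for n
  define S where "S n = X n - F n" for n
  have XS: "X n \<subseteq> X (Suc n)" for n using XF FX by blast
  then have Xmono: "X m \<subseteq> X n" if "m \<le> n" for m n using that by (rule lift_Suc_mono_le)
  have S0: "S 0 = {}" and SS: "S (Suc n) \<subseteq> Y n" and finS: "finite (S n)" for n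
    using X0 XF[of n] fin by (auto simp: S_def Y_def)
  have Yex: "\<exists>n. v \<in> Y n" if v: "v \<in> verts G" for v
  proof -
    have ex: "\<exists>n. v \<in> X n" using v cover by auto
    define m where "m = (LEAST n. v \<in> X n)"
    have "v \<in> X m" unfolding m_def by (rule LeastI_ex[OF ex])
    moreover have "v \<notin> X i" if "i < m" for i using not_less_Least that unfolding m_def by blast
    moreover from \<open>v \<in> X m\<close> obtain n where "m = Suc n" using X0 by (cases m) auto
    ultimately show ?thesis by (auto simp: Y_def)
  qed
  have Yuniq: "m = n" if "v \<in> Y m" "v \<in> Y n" for v m n
  proof (rule ccontr)
    assume "m \<noteq> n"
    then consider "Suc m \<le> n" | "Suc n \<le> m" by linarith
    then show False using that Xmono[of "Suc m" n] Xmono[of "Suc n" m] by cases (auto simp: Y_def)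
  qed
  have YV: "Y n \<subseteq> verts G" for n using cover by (auto simp: Y_def)
  let ?H = "\<lambda>n. induced G (Y n)"
  have H: "subgraph (?H n) G" for n by (rule subgraph_induced[OF G YV])
  have vH: "verts (?H n) = Y n" for n by (simp add: induced_def)
  define Q where "Q n B T \<longleftrightarrow> path_decomposition (?H n) B \<and>
      (\<forall>t. finite (B t) \<and> card (B t) \<le> Suc c) \<and> (\<forall>v \<in> Y n. \<exists>t<T. v \<in> B t) \<and>
      (\<forall>v w. {v, w} \<in> edges (?H n) \<longrightarrow> (\<exists>t<T. v \<in> B t \<and> w \<in> B t)) \<and> 0 < T"
    for n and B :: "nat \<Rightarrow> 'a set" and T :: nat
  have "\<exists>B T. Q n B T" for n
  proof -
    have "countable_simple_graph (?H n)" using H[of n] by (simp add: subgraph_def)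
    moreover have fH: "finite (verts (?H n))" unfolding vH by (simp add: Y_def fin)
    ultimately obtain B T where "path_decomposition (?H n) B"
      "\<And>t. finite (B t)" "\<And>t. card (B t) \<le> Suc c"
      "\<And>v. v \<in> verts (?H n) \<Longrightarrow> \<exists>t<T. v \<in> B t"
      "\<And>v w. {v, w} \<in> edges (?H n) \<Longrightarrow> \<exists>t<T. v \<in> B t \<and> w \<in> B t" "0 < T"
      by (rule finite_path_decomposition[OF _ _ pw[OF H fH]]) blast
    then have "Q n B T" unfolding Q_def vH by blast
    then show ?thesis by blast
  qed
  then obtain D T where Q: "\<And>n. Q n (D n) (T n)" by metis
  have D: "path_decomposition (?H n) (D n)" and T: "0 < T n"
    and Dcard: "finite (D n t)" "card (D n t) \<le> Suc c"
    and Dv: "v \<in> Y n \<Longrightarrow> \<exists>t<T n. v \<in> D n t"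
    and De: "{v, w} \<in> edges (?H n) \<Longrightarrow> \<exists>t<T n. v \<in> D n t \<and> w \<in> D n t" for n t v w
    using Q[of n] unfolding Q_def by blast+
  have DY: "D n t \<subseteq> Y n" for n t
    using path_decompositionD(1)[OF D[of n]] vH by blast
  have Dint: "v \<in> D n t2" if "v \<in> D n t1" "v \<in> D n t3" "t1 \<le> t2" "t2 \<le> t3" for v n t1 t2 t3
  proof -
    have "D n t1 \<inter> D n t3 \<subseteq> D n t2"
      using path_decompositionD(3)[OF D] that(3,4) .
    then show ?thesis using that by blast
  qed
  obtain b r :: "nat \<Rightarrow> nat"
    where b: "mono b" and r: "\<And>n t. t < T n \<Longrightarrow> \<exists>s. b s = n \<and> r s = t"
      and rmono: "\<And>s s'. s \<le> s' \<Longrightarrow> b s = b s' \<Longrightarrow> r s \<le> r s'"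
    by (rule block_index[of T, OF T]) (rule that; assumption)
  \<comment> \<open>Adding \<open>S n\<close> to block \<open>n\<close> covers the edges coming from
    the previous difference. Adding \<open>S (Suc n)\<close> as well makes its vertices fill all of
    block \<open>n\<close>, so that they leave no gap before block \<open>Suc n\<close>.\<close>
  define B where "B t = S (b t) \<union> S (Suc (b t)) \<union> D (b t) (r t)" for t
  have BV: "B t \<subseteq> verts G" for t
  proof -
    have "S n \<subseteq> verts G" for n using cover by (auto simp: S_def)
    moreover have "D n t' \<subseteq> verts G" for n t' using DY YV by blast
    ultimately show ?thesis by (simp add: B_def)
  qed
  \<comment> \<open>A boundary vertex fills exactly two consecutive blocks; any other vertex stays
    in its own block and occurs there as in \<open>D n\<close>. The interval property is read off
    from this.\<close>
  have mem: "v \<in> B t \<longleftrightarrow> (v \<in> S (Suc n) \<and> (b t = n \<or> b t = Suc n)) \<or> (b t = n \<and> v \<in> D n (r t))"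
    if v: "v \<in> Y n" for v n t
  proof -
    have *: "m = Suc n" if "v \<in> S m" for m
    proof (cases m)
      case (Suc m')
      with that SS have "v \<in> Y m'" by auto
      then show ?thesis using Yuniq[OF _ v] Suc by simp
    qed (use that S0 in simp)
    have D: "v \<notin> D m t'" if "m \<noteq> n" for m t'
      using Yuniq[OF subsetD[OF DY] v] that by blast
    show ?thesis
    proof (cases "b t = n")
      case True
      have "v \<notin> S n" using *[of n] by auto
      then show ?thesis using True by (simp add: B_def)
    next
      case False
      have "v \<notin> S (Suc (b t))" using *[of "Suc (b t)"] False by blast
      moreover have "v \<notin> S (b t)" if "b t \<noteq> Suc n" using *[of "b t"] that by blast
      ultimately show ?thesis using False D[OF False] by (cases "b t = Suc n") (simp_all add: B_def)
    qed
  qed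
  have vB: "\<exists>t. v \<in> B t \<and> b t = n" if v: "v \<in> Y n" for v n
  proof -
    obtain t' where t': "t' < T n" "v \<in> D n t'" using Dv[OF v] by blast
    obtain t where "b t = n" "r t = t'" using r[OF t'(1)] by blast
    then show ?thesis using t' by (auto simp: B_def)
  qed
  have edge: "\<exists>t. v \<in> B t \<and> w \<in> B t"
    if vw: "{v, w} \<in> edges G" "v \<in> Y m" "w \<in> Y n" "m \<le> n" for v w m n
  proof (cases "m = n")
    case True
    then have "{v, w} \<in> edges (?H n)" using vw by (simp add: induced_def)
    from De[OF this] obtain t' where t': "t' < T n" "v \<in> D n t'" "w \<in> D n t'" by blast
    obtain t where "b t = n" "r t = t'" using r[OF t'(1)] by blast
    then show ?thesis using t' by (auto simp: B_def)
  next
    case False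
    have w: "w \<in> neighbours G v" using vw edge_verts[OF G] by (auto simp: neighbours_def)
    have wX: "w \<notin> X n" using vw by (simp add: Y_def)
    have vX: "v \<in> X (Suc m)" using vw by (simp add: Y_def)
    \<comment> \<open>Two steps later \<open>v\<close> is interior, so all its neighbours have been
      absorbed; hence \<open>w\<close> lies in the very next difference. If \<open>v\<close> were
      interior one step earlier, \<open>w\<close> would belong to \<open>X n\<close>.\<close>
    have "v \<in> F (Suc (Suc m))" using vX XF by blast
    then have "w \<in> X (Suc (Suc m))" using nbrs w by blast
    then have "\<not> Suc (Suc m) \<le> n" using Xmono wX by blast
    then have n: "n = Suc m" using False \<open>m \<le> n\<close> by simp
    have "v \<notin> F (Suc m)" using nbrs w wX n by blast
    then have "v \<in> S n" using vX n by (simp add: S_def)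
    moreover obtain t where "w \<in> B t" "b t = n" using vB vw by blast
    ultimately show ?thesis by (auto simp: B_def)
  qed
  have "path_decomposition G B"
    unfolding path_decomposition_def
  proof (intro conjI allI impI)
    show "(\<Union>t. B t) = verts G"
    proof
      show "verts G \<subseteq> (\<Union>t. B t)"
      proof
        fix v assume "v \<in> verts G"
        then obtain n where "v \<in> Y n" using Yex by blast
        from vB[OF this] show "v \<in> (\<Union>t. B t)" by blast
      qed
    qed (use BV in blast)
    show "\<exists>t. v \<in> B t \<and> w \<in> B t" if vw: "{v, w} \<in> edges G" for v w
    proof -
      obtain m n where mn: "v \<in> Y m" "w \<in> Y n" using edge_verts[OF G vw] Yex by metis
      have wv: "{w, v} \<in> edges G" using vw by (simp add: insert_commute)
      show ?thesis
        using edge[OF vw mn] edge[OF wv mn(2,1)] linear[of m n] by blast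
    qed
    show "B t1 \<inter> B t3 \<subseteq> B t2" if t: "t1 \<le> t2 \<and> t2 \<le> t3" for t1 t2 t3
    proof
      fix v assume v: "v \<in> B t1 \<inter> B t3"
      then have "v \<in> verts G" using BV by blast
      then obtain n where n: "v \<in> Y n" using Yex by blast
      have bt: "b t1 \<le> b t2" "b t2 \<le> b t3" using t b by (auto dest: monoD)
      show "v \<in> B t2"
      proof (cases "v \<in> S (Suc n)")
        case True
        have "b t = n \<or> b t = Suc n" if "v \<in> B t" for t
          using that unfolding mem[OF n] by blast
        then have "n \<le> b t1" "b t3 \<le> Suc n" using v by force+
        then have "b t2 = n \<or> b t2 = Suc n" using bt by linarith
        then show ?thesis using True by (simp add: mem[OF n])
      next
        case False
        then have *: "b t1 = n" "b t3 = n" "v \<in> D n (r t1)" "v \<in> D n (r t3)"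
          using v by (simp_all add: mem[OF n])
        then have "b t2 = n" using bt by linarith
        then have "r t1 \<le> r t2" "r t2 \<le> r t3" using t * by (simp_all add: rmono)
        then have "v \<in> D n (r t2)" using Dint[OF *(3,4)] by simp
        then show ?thesis using \<open>b t2 = n\<close> by (simp add: mem[OF n])
      qed
    qed
  qed
  moreover have "finite (B t)" for t using finS Dcard by (simp add: B_def)
  moreover have "card (B t) \<le> 2 * s + Suc c" for t
  proof -
    have "card (B t) \<le> card (S (b t) \<union> S (Suc (b t))) + card (D (b t) (r t))"
      unfolding B_def by (rule card_Un_le)
    also have "card (S (b t) \<union> S (Suc (b t))) \<le> card (S (b t)) + card (S (Suc (b t)))"
      by (rule card_Un_le)
    finally show ?thesis
      using card[of "b t"] card[of "Suc (b t)"] Dcard(2)[of "b t" "r t"] unfolding S_def by linarith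
  qed
  ultimately show thesis by (rule that)
qed

section \<open>Restoring the vertices of infinite degree and the final bound\<close>

lemma path_decomposition_add_verts:
  assumes G: "countable_simple_graph G" and D: "D \<subseteq> verts G"
    and B: "path_decomposition (induced G (verts G - D)) B"
  shows "path_decomposition G (\<lambda>t. B t \<union> D)"
proof -
  have U: "(\<Union>t. B t) = verts G - D"
    and E: "\<And>v w. {v, w} \<in> edges G \<Longrightarrow> v \<notin> D \<Longrightarrow> w \<notin> D \<Longrightarrow> \<exists>t. v \<in> B t \<and> w \<in> B t"
    and C: "\<And>t1 t2 t3. t1 \<le> t2 \<Longrightarrow> t2 \<le> t3 \<Longrightarrow> B t1 \<inter> B t3 \<subseteq> B t2"
    using path_decompositionD[OF B] edge_verts[OF G] by (simp_all add: induced_def)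
  have V: "\<exists>t. v \<in> B t \<union> D" if "v \<in> verts G" for v using U that by blast
  show ?thesis
    unfolding path_decomposition_def
  proof (intro conjI allI impI)
    show "(\<Union>t. B t \<union> D) = verts G" using U D by auto
    show "\<exists>t. v \<in> B t \<union> D \<and> w \<in> B t \<union> D" if "{v, w} \<in> edges G" for v w
      using E[OF that] V[OF edge_verts(1)[OF G that]] V[OF edge_verts(2)[OF G that]] by blast
    show "(B t1 \<union> D) \<inter> (B t3 \<union> D) \<subseteq> B t2 \<union> D" if "t1 \<le> t2 \<and> t2 \<le> t3" for t1 t2 t3
      using C that by blast
  qed
qed

theorem theorem1:
  fixes G :: "'a ugraph" and d c k :: nat
  assumes "countable_simple_graph G"
    and "k \<ge> 1"
    and "finite (infinite_degree_verts G)" and "card (infinite_degree_verts G) \<le> d"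
    and "\<not> contains_disjoint_rays G k"
    and "\<And>H. subgraph H G \<Longrightarrow> finite (verts H) \<Longrightarrow> pathwidth H \<le> ereal (real c)"
  shows "pathwidth G \<le> ereal (2 * real c + (3 * real k - 2) * (2 * real c + 1) + real d)"
proof -
  define D where "D = infinite_degree_verts G"
  define G' where "G' = induced G (verts G - D)"
  have DG: "D \<subseteq> verts G" by (auto simp: D_def infinite_degree_verts_def)
  have sub: "subgraph G' G"
    unfolding G'_def by (rule subgraph_induced[OF assms(1)]) auto
  then have simple: "countable_simple_graph G'" by (simp add: subgraph_def)
  have locfin: "finite (neighbours G' v)" if "v \<in> verts G'" for v
  proof (rule finite_subset)
    show "neighbours G' v \<subseteq> neighbours G v"
      by (auto simp: neighbours_def G'_def induced_def)
    show "finite (neighbours G v)"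
      using that by (auto simp: G'_def induced_def D_def infinite_degree_verts_def)
  qed
  have rays: "\<not> contains_disjoint_rays G' k"
    using assms(5) contains_disjoint_rays_subgraph sub by blast
  obtain F X where "separator_exhaustion G' (k - 1) F X"
    using separator_exhaustion_exists[OF simple locfin rays] by blast
  then obtain B where B: "path_decomposition G' B" "\<And>t. finite (B t)"
    "\<And>t. card (B t) \<le> 2 * (k - 1) + Suc c"
    using path_decomposition_concat[OF simple _ assms(6)[OF subgraph_trans[OF _ sub]]] by metis
  have dec: "path_decomposition G (\<lambda>t. B t \<union> D)"
    using path_decomposition_add_verts[OF assms(1) DG] B(1) by (simp add: G'_def)
  have "card (B t \<union> D) \<le> 2 * (k - 1) + Suc c + d" for t
    using card_Un_le[of "B t" D] B(3)[of t] assms(4) by (simp add: D_def)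
  then have w: "width (\<lambda>t. B t \<union> D) \<le> ereal (real (2 * (k - 1) + Suc c + d) - 1)"
    using B(2) assms(3) by (simp add: width_le_iff D_def del: of_nat_add of_nat_Suc)
  have "pathwidth G \<le> width (\<lambda>t. B t \<union> D)"
    unfolding pathwidth_def using dec by (intro INF_lower) simp
  also note w
  \<comment> \<open>Writing \<open>k\<close> as \<open>Suc m\<close> removes the truncated
    subtraction. The only nonlinear term left is a multiple of \<open>m * c\<close>, which is
    nonnegative and stands on the larger side.\<close>
  also have "real (2 * (k - 1) + Suc c + d) - 1
      \<le> 2 * real c + (3 * real k - 2) * (2 * real c + 1) + real d"
  proof -
    obtain m where m: "k = Suc m" using assms(2) by (cases k) auto
    have "0 \<le> real m * real c" by simp
    then show ?thesis by (simp add: m algebra_simps)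
  qed
  finally show ?thesis by simp
qed

end
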